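(* Let $\mathbb{X}=\{0,1,\dots,D_X-1\}$ and $\mathbb{Y}=\{0,1,\dots,D_Y-1\}$, and let $B:\mathcal{G}\to\mathbb{Y}^+$ be a local grammar encoder whose natural number encoder satisfies $\limsup_{n\to\infty}|B_S(n)|/\log_{D_Y}n=1$. Let $\mathcal{J}\supset\mathcal{B}$ be a sufficient subclass of grammars. Then every $(B,\mathcal{J})$-minimal code $C$ satisfies $$\limsup_{n\to\infty}\frac{|C(X_{1:n})|\log D_Y}{n}\le h\quad\text{almost surely}$$ for every stationary ergodic process $(X_k)_{k\in\mathbb{Z}}$ over $\mathbb{X}$ with entropy rate $h>0$.
   Context: $\log$ is natural; entropy rate $h:=\lim_n H(X_{1:n})/n$. An admissible grammar is a tuple $\mathsf{G}=(\alpha_1,\dots,\alpha_n)$ for rules $A_i\to\alpha_i$, start symbol $A_1$, with $\alpha_i\in(\{A_{i+1},\dots,A_n\}\cup\mathbb{X})^*$; it generates exactly one string. $\mathcal{G}$ is the set of admissible grammars, $\mathcal{G}(w)$ those generating $w$. A subclass $\mathcal{J}\subset\mathcal{G}$ is sufficient if $\mathcal{G}(w)\cap\mathcal{J}\neq\emptyset$ for all $w\in\mathbb{X}^+$. With $f^*(x_1\cdots x_m):=f(x_1)\cdots f(x_m)$, a local grammar encoder is $B(\mathsf{G})=B_S^*(B_N(\mathsf{G}))$, where $B_N(\mathsf{G}):=F_1^*(\alpha_1)\,D_X\,F_2^*(\alpha_2)\,D_X\cdots D_X\,F_n^*(\alpha_n)\,(D_X+1)$, $F_i(x)=x$ for $x\in\mathbb{X}$,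 $F_i(A_j)=D_X+1+j-i$, and $B_S:\{0\}\cup\mathbb{N}\to\mathbb{Y}^+$ is injective with prefix-free image and nondecreasing length. A code $C=B(\Gamma(\cdot))$ is $(B,\mathcal{J})$-minimal if $\Gamma:\mathbb{X}^+\to\mathcal{J}$ satisfies $\Gamma(w)\in\mathcal{G}(w)\cap\mathcal{J}$ and $|B(\Gamma(w))|\le|B(\mathsf{G})|$ for all $\mathsf{G}\in\mathcal{G}(w)\cap\mathcal{J}$, $w\in\mathbb{X}^+$. $\mathcal{B}=\bigcup_{k\ge1}\mathcal{B}_k$, where $\mathcal{B}_k$ is the set of grammars $(uw,\alpha_2,\dots,\alpha_n)$ with $\alpha_i\in\mathbb{X}^k$ for $i\ge2$, $u$ a string over $\{A_2,\dots,A_n\}$ in which each of $A_2,\dots,A_n$ appears, and $w\in\mathbb{X}^*$ with $|w|<k$. *)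

theory Defs
  imports "HOL-Probability.Probability"
begin

text \<open>Grammar symbols: terminals Ter x (x in {0..<D_X}) and nonterminals Non j standing for A_j
  (1-based, A_1 is the start symbol). A grammar is the list of right-hand sides
  [alpha_1, ..., alpha_n]; list index i holds alpha_(i+1).\<close>

datatype gsym = Ter nat | Non nat

definition admissible :: "nat \<Rightarrow> gsym list list \<Rightarrow> bool" where
  "admissible DX G \<longleftrightarrow> G \<noteq> [] \<and>
     (\<forall>i<length G. \<forall>s\<in>set (G ! i).
        (case s of Ter x \<Rightarrow> x < DX | Non j \<Rightarrow> i + 1 < j \<and> j \<le> length G))"

text \<open>Expansion of nonterminal A_i with fuel k (fuel = length G suffices for admissible grammars).\<close>
fun expf :: "nat \<Rightarrow> gsym list list \<Rightarrow> nat \<Rightarrow> nat list" where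
  "expf 0 G i = []"
| "expf (Suc k) G i =
     concat (map (\<lambda>s. case s of Ter x \<Rightarrow> [x] | Non j \<Rightarrow> expf k G j) (G ! (i - 1)))"

definition generates :: "nat \<Rightarrow> gsym list list \<Rightarrow> nat list \<Rightarrow> bool" where
  "generates DX G w \<longleftrightarrow> admissible DX G \<and> expf (length G) G 1 = w"

definition Fsym :: "nat \<Rightarrow> nat \<Rightarrow> gsym \<Rightarrow> nat" where
  "Fsym DX i s = (case s of Ter x \<Rightarrow> x | Non j \<Rightarrow> DX + 1 + j - i)"

definition BN :: "nat \<Rightarrow> gsym list list \<Rightarrow> nat list" where
  "BN DX G = concat (map (\<lambda>i. map (Fsym DX i) (G ! (i - 1)) @
                                 [if i = length G then DX + 1 else DX]) [1..<length G + 1])"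

definition nat_encoder :: "nat \<Rightarrow> (nat \<Rightarrow> nat list) \<Rightarrow> bool" where
  "nat_encoder DY BS \<longleftrightarrow> inj BS \<and>
     (\<forall>m n. m \<noteq> n \<longrightarrow> \<not> (\<exists>z. BS n = BS m @ z)) \<and>
     (\<forall>n. BS n \<noteq> [] \<and> set (BS n) \<subseteq> {..<DY}) \<and>
     mono (\<lambda>n. length (BS n))"

definition local_encoder :: "nat \<Rightarrow> (nat \<Rightarrow> nat list) \<Rightarrow> gsym list list \<Rightarrow> nat list" where
  "local_encoder DX BS G = concat (map BS (BN DX G))"

definition inB :: "nat \<Rightarrow> gsym list list \<Rightarrow> bool" where
  "inB DX G \<longleftrightarrow> G \<noteq> [] \<and> (\<exists>k\<ge>1. \<exists>u w. G ! 0 = u @ w \<and>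
       set u \<subseteq> Non ` {2..length G} \<and> Non ` {2..length G} \<subseteq> set u \<and>
       set w \<subseteq> Ter ` {..<DX} \<and> length w < k \<and>
       (\<forall>i\<in>{1..<length G}. length (G ! i) = k \<and> set (G ! i) \<subseteq> Ter ` {..<DX}))"

definition sufficient :: "nat \<Rightarrow> gsym list list set \<Rightarrow> bool" where
  "sufficient DX J \<longleftrightarrow> J \<subseteq> {G. admissible DX G} \<and>
     (\<forall>w. w \<noteq> [] \<and> set w \<subseteq> {..<DX} \<longrightarrow> (\<exists>G\<in>J. generates DX G w))"

definition minimal_code ::
  "nat \<Rightarrow> (nat \<Rightarrow> nat list) \<Rightarrow> gsym list list set \<Rightarrow> (nat list \<Rightarrow> gsym list list) \<Rightarrow> bool" where
  "minimal_code DX BS J \<Gamma> \<longleftrightarrow>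
     (\<forall>w. w \<noteq> [] \<and> set w \<subseteq> {..<DX} \<longrightarrow>
        \<Gamma> w \<in> J \<and> generates DX (\<Gamma> w) w \<and>
        (\<forall>G\<in>J. generates DX G w \<longrightarrow>
            length (local_encoder DX BS (\<Gamma> w)) \<le> length (local_encoder DX BS G)))"

definition stationary_process :: "'a measure \<Rightarrow> (int \<Rightarrow> 'a \<Rightarrow> nat) \<Rightarrow> bool" where
  "stationary_process M X \<longleftrightarrow>
     (\<forall>k::int. distr M (PiM UNIV (\<lambda>_. count_space UNIV)) (\<lambda>\<omega> i. X (i + k) \<omega>) =
               distr M (PiM UNIV (\<lambda>_. count_space UNIV)) (\<lambda>\<omega> i. X i \<omega>))"

definition ergodic_process :: "'a measure \<Rightarrow> (int \<Rightarrow> 'a \<Rightarrow> nat) \<Rightarrow> bool" where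
  "ergodic_process M X \<longleftrightarrow>
     (\<forall>S \<in> sets (PiM (UNIV::int set) (\<lambda>_. count_space (UNIV::nat set))).
        (\<forall>f. f \<in> S \<longleftrightarrow> (\<lambda>i. f (i + 1)) \<in> S) \<longrightarrow>
        measure M {\<omega>\<in>space M. (\<lambda>i. X i \<omega>) \<in> S} = 0 \<or>
        measure M {\<omega>\<in>space M. (\<lambda>i. X i \<omega>) \<in> S} = 1)"

definition block_prob :: "'a measure \<Rightarrow> (int \<Rightarrow> 'a \<Rightarrow> nat) \<Rightarrow> nat list \<Rightarrow> real" where
  "block_prob M X w = measure M {\<omega>\<in>space M. \<forall>i<length w. X (int i + 1) \<omega> = w ! i}"

definition block_entropy :: "nat \<Rightarrow> 'a measure \<Rightarrow> (int \<Rightarrow> 'a \<Rightarrow> nat) \<Rightarrow> nat \<Rightarrow> real" where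
  "block_entropy DX M X n =
     - (\<Sum>w\<in>{w. length w = n \<and> set w \<subseteq> {..<DX}}. block_prob M X w * ln (block_prob M X w))"

end

theory Submission
  imports Defs
begin

text \<open>Parse the string into blocks of a fixed length k and let each block that occurs be one rule,
  the rules being ordered by decreasing Q-probability for a probability Q on k-blocks. The j-th rule
  then has Q-probability at most 1/j, so a reference to the rule of b costs
  (1 + o(1)) (- ln Q b) + O(1) nats, while the rule bodies cost a constant independent of the length
  of the string. For Q take the order-m Markov approximation of the process. Then - ln Q b is, up to
  m ln D per block, a sum of conditional informations over positions of the string, so consecutive
  blocks need only the upper half of Birkhoff's theorem for the shift itself; the possible
  non-ergodicity of its k-th power plays no role. The rate is
  (1 + o(1)) (H(m+1) - H(m)) + O(1/k). Some increment H(m+1) - H(m) is close to h because their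
  averages tend to h; finally k is taken large.\<close>

section \<open>The upper half of the ergodic theorem\<close>

text \<open>The maximum of the Birkhoff sums of lengths 0 to n, the empty sum being 0. In this
  recursive form the relation between the maxima at x and at \<open>T x\<close> holds by
  unfolding.\<close>

fun max_birkhoff_sum :: "('b \<Rightarrow> 'b) \<Rightarrow> ('b \<Rightarrow> real) \<Rightarrow> nat \<Rightarrow> 'b \<Rightarrow> real" where
  "max_birkhoff_sum T F 0 x = 0"
| "max_birkhoff_sum T F (Suc n) x = max 0 (F x + max_birkhoff_sum T F n (T x))"

lemma max_birkhoff_sum_nonneg: "0 \<le> max_birkhoff_sum T F n x"
  by (cases n) auto

lemma max_birkhoff_sum_mono: "max_birkhoff_sum T F n x \<le> max_birkhoff_sum T F (Suc n) x"
proof (induction n arbitrary: x)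
  case (Suc n)
  have "F x + max_birkhoff_sum T F n (T x) \<le> F x + max_birkhoff_sum T F (Suc n) (T x)"
    using Suc by (intro add_left_mono)
  then show ?case
    using max_birkhoff_sum.simps(2)[of T F n x] max_birkhoff_sum.simps(2)[of T F "Suc n" x]
    by linarith
qed simp

lemma birkhoff_sum_le_max: "(\<Sum>i<n. F ((T ^^ i) x)) \<le> max_birkhoff_sum T F n x"
proof (induction n arbitrary: x)
  case (Suc n)
  have "(\<Sum>i<Suc n. F ((T ^^ i) x)) = F x + (\<Sum>i<n. F ((T ^^ i) (T x)))"
    by (simp add: sum.lessThan_Suc_shift funpow_Suc_right del: sum.lessThan_Suc funpow.simps)
  also have "\<dots> \<le> F x + max_birkhoff_sum T F n (T x)"
    using Suc by (intro add_left_mono)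
  finally show ?case by simp
qed simp

lemma measurable_max_birkhoff_sum:
  assumes [measurable]: "T \<in> measurable N N" "F \<in> borel_measurable N"
  shows "max_birkhoff_sum T F n \<in> borel_measurable N"
proof (induction n)
  case (Suc n)
  note [measurable] = Suc
  have "max_birkhoff_sum T F (Suc n) = (\<lambda>x. max 0 (F x + max_birkhoff_sum T F n (T x)))"
    by auto
  then show ?case by simp
qed auto

lemma integrable_comp_preserving:
  fixes F :: "'b \<Rightarrow> real"
  assumes "T \<in> measurable N N" "distr N N T = N" "integrable N F"
  shows "integrable N (\<lambda>x. F (T x))"
  using integrable_distr[of T N N F] assms by simp

lemma integral_comp_preserving:
  fixes F :: "'b \<Rightarrow> real"
  assumes "T \<in> measurable N N" "distr N N T = N" "integrable N F"
  shows "(\<integral>x. F (T x) \<partial>N) = (\<integral>x. F x \<partial>N)"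
  using integral_distr[of T N N F] assms by simp

lemma integrable_max_birkhoff_sum:
  assumes T: "T \<in> measurable N N" and "distr N N T = N" and F: "integrable N F"
  shows "integrable N (max_birkhoff_sum T F n)"
proof (induction n)
  case 0
  have "max_birkhoff_sum T F 0 = (\<lambda>x. 0)" by auto
  then show ?case by simp
next
  case (Suc n)
  have "max_birkhoff_sum T F (Suc n) = (\<lambda>x. max 0 (F x + max_birkhoff_sum T F n (T x)))"
    by auto
  then show ?case
    using integrable_comp_preserving[OF assms(1,2) Suc] F
    by (simp add: integrable_max)
qed

text \<open>Garsia's argument. Write G_n for the maximum. Where G_n is positive, it equals F x +
  G_(n-1)(T x), hence is at most F x + G_n(T x); elsewhere G_n x = 0 \<le> G_n(T x). So G_n x -
  G_n(T x) lies below the integrand, and it integrates to 0 by invariance.\<close>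

lemma maximal_ergodic_inequality:
  assumes T: "T \<in> measurable N N" and pres: "distr N N T = N" and F: "integrable N F"
  shows "0 \<le> (\<integral>x. (if max_birkhoff_sum T F n x > 0 then F x else 0) \<partial>N)"
proof -
  let ?G = "max_birkhoff_sum T F"
  have [measurable]: "?G m \<in> borel_measurable N" "F \<in> borel_measurable N" for m
    using measurable_max_birkhoff_sum[OF T] F by auto
  have iG: "integrable N (?G n)"
    by (rule integrable_max_birkhoff_sum[OF assms])
  have iGT: "integrable N (\<lambda>x. ?G n (T x))"
    by (rule integrable_comp_preserving[OF T pres iG])
  have "0 = (\<integral>x. ?G n x \<partial>N) - (\<integral>x. ?G n (T x) \<partial>N)"
    using integral_comp_preserving[OF T pres iG] by simp
  also have "\<dots> = (\<integral>x. ?G n x - ?G n (T x) \<partial>N)"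
    using iG iGT by simp
  also have "\<dots> \<le> (\<integral>x. (if ?G n x > 0 then F x else 0) \<partial>N)"
  proof (rule integral_mono)
    show "integrable N (\<lambda>x. if ?G n x > 0 then F x else 0)"
      by (rule Bochner_Integration.integrable_bound[OF F]) auto
    fix x
    show "?G n x - ?G n (T x) \<le> (if ?G n x > 0 then F x else 0)"
    proof (cases n)
      case (Suc m)
      show ?thesis
        using max_birkhoff_sum_mono[of T F m "T x"] max_birkhoff_sum_nonneg[of T F n "T x"]
        unfolding Suc by (auto simp del: max_birkhoff_sum.simps(2) simp add: max_birkhoff_sum.simps(2)[of T F m x])
    qed simp
  qed (use iG iGT in auto)
  finally show ?thesis .
qed

text \<open>The sets where the maxima are positive increase to a set of full measure, so the maximal
  inequality passes to the limit by dominated convergence.\<close>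

lemma integral_nonneg_of_max_birkhoff_sum_pos:
  assumes T: "T \<in> measurable N N" and pres: "distr N N T = N" and F: "integrable N F"
    and pos: "AE x in N. \<exists>n. max_birkhoff_sum T F n x > 0"
  shows "0 \<le> (\<integral>x. F x \<partial>N)"
proof -
  let ?G = "max_birkhoff_sum T F"
  let ?f = "\<lambda>n x. if ?G n x > 0 then F x else 0"
  have [measurable]: "?G m \<in> borel_measurable N" "F \<in> borel_measurable N" for m
    using measurable_max_birkhoff_sum[OF T] F by auto
  have "(\<lambda>n. \<integral>x. ?f n x \<partial>N) \<longlonglongrightarrow> (\<integral>x. F x \<partial>N)"
  proof (rule integral_dominated_convergence[where w = "\<lambda>x. norm (F x)"])
    show "AE x in N. (\<lambda>n. ?f n x) \<longlonglongrightarrow> F x"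
      using pos
    proof eventually_elim
      case (elim x)
      then obtain n where n: "?G n x > 0" by auto
      have "incseq (\<lambda>n. ?G n x)"
        by (rule incseq_SucI) (rule max_birkhoff_sum_mono)
      then have "?G n x \<le> ?G m x" if "m \<ge> n" for m
        using that by (rule incseqD)
      then have "?f m x = F x" if "m \<ge> n" for m
        using n that by (auto intro: less_le_trans)
      then have "eventually (\<lambda>m. ?f m x = F x) sequentially"
        unfolding eventually_sequentially by blast
      then show ?case by (rule tendsto_eventually)
    qed
  qed (use F in auto)
  then show ?thesis
    by (rule LIMSEQ_le_const) (auto intro!: exI maximal_ergodic_inequality[OF T pres F])
qed

text \<open>Only the upper half of Birkhoff's theorem is needed. Unboundedness of the sums from above is
  exactly invariant, so ergodicity applies to it without passing to limits.\<close>
lemma birkhoff_sums_bounded_above: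
  fixes F :: "'b \<Rightarrow> real"
  assumes "prob_space N" and T: "T \<in> measurable N N" and pres: "distr N N T = N"
    and erg: "\<And>S. S \<in> sets N \<Longrightarrow> (\<forall>x\<in>space N. x \<in> S \<longleftrightarrow> T x \<in> S) \<Longrightarrow> measure N S = 0 \<or> measure N S = 1"
    and F: "integrable N F" and neg: "(\<integral>x. F x \<partial>N) < 0"
  shows "AE x in N. \<exists>K. \<forall>n. (\<Sum>i<n. F ((T ^^ i) x)) \<le> K"
proof -
  interpret prob_space N by fact
  define A where "A = {x\<in>space N. \<forall>K::nat. \<exists>n. (\<Sum>i<n. F ((T ^^ i) x)) > real K}"
  have [measurable]: "F \<in> borel_measurable N" using F by auto
  have [measurable]: "(T ^^ i) \<in> measurable N N" for i
    using T measurable_compose_n by blast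
  have A: "A \<in> sets N" unfolding A_def by measurable
  have shift: "(\<Sum>i<Suc n. F ((T ^^ i) x)) = F x + (\<Sum>i<n. F ((T ^^ i) (T x)))" for n x
    by (simp add: sum.lessThan_Suc_shift funpow_Suc_right del: sum.lessThan_Suc funpow.simps)
  have "x \<in> A \<longleftrightarrow> T x \<in> A" if x: "x \<in> space N" for x
  proof -
    have Tx: "T x \<in> space N" using measurable_space[OF T x] .
    \<comment> \<open>The sums along x and along \<open>T x\<close> differ by the single term
      \<open>F x\<close>. Raising the threshold by \<open>a\<close> therefore carries unboundedness
      over in both directions.\<close>
    obtain a :: nat where a: "\<bar>F x\<bar> \<le> real a" using real_arch_simple by blast
    show ?thesis
    proof
      assume "x \<in> A"
      have "\<exists>n. (\<Sum>i<n. F ((T ^^ i) (T x))) > real K" for K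
      proof -
        obtain n where n: "(\<Sum>i<n. F ((T ^^ i) x)) > real (K + a)"
          using \<open>x \<in> A\<close> unfolding A_def by blast
        \<comment> \<open>The empty sum cannot exceed the nonnegative threshold.\<close>
        then obtain m where "n = Suc m" by (cases n) auto
        with n shift[of x m] a show ?thesis by (intro exI[of _ m]) auto
      qed
      then show "T x \<in> A" using Tx by (auto simp: A_def)
    next
      assume "T x \<in> A"
      have "\<exists>n. (\<Sum>i<n. F ((T ^^ i) x)) > real K" for K
      proof -
        obtain n where n: "(\<Sum>i<n. F ((T ^^ i) (T x))) > real (K + a)"
          using \<open>T x \<in> A\<close> unfolding A_def by blast
        with shift[of x n] a show ?thesis by (intro exI[of _ "Suc n"]) auto
      qed
      then show "x \<in> A" using x by (auto simp: A_def)
    qed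
  qed
  then have "prob A = 0 \<or> prob A = 1" using erg[OF A] by blast
  moreover have "prob A \<noteq> 1"
  proof
    assume "prob A = 1"
    then have "AE x in N. x \<in> A" using A by (simp add: AE_in_set_eq_1)
    then have "AE x in N. \<exists>n. max_birkhoff_sum T F n x > 0"
    proof eventually_elim
      case (elim x)
      then obtain n where "(\<Sum>i<n. F ((T ^^ i) x)) > real 0" unfolding A_def by blast
      then show ?case using birkhoff_sum_le_max[of F T x n] by (intro exI[of _ n]) auto
    qed
    from integral_nonneg_of_max_birkhoff_sum_pos[OF T pres F this] neg show False by simp
  qed
  ultimately have "prob A = 0" by simp
  then have "AE x in N. x \<notin> A"
    using A by (simp add: AE_iff_measurable[OF A] emeasure_eq_measure A_def)
  then show ?thesis
    by (rule AE_mp) (auto intro!: AE_I2 simp: A_def not_less)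
qed

section \<open>Block grammars\<close>

lemma encoder_length_bound:
  fixes BS :: "nat \<Rightarrow> nat list"
  assumes DY: "DY \<ge> (2::nat)"
    and lim: "limsup (\<lambda>n. ereal (real (length (BS n)) / log (real DY) (real n))) = 1"
    and e: "\<epsilon> > 0"
  obtains C where "C \<ge> 0" and "\<And>n. n \<ge> 1 \<Longrightarrow> real (length (BS n)) * ln (real DY) \<le> (1 + \<epsilon>) * ln (real n) + C"
proof -
  have "limsup (\<lambda>n. ereal (real (length (BS n)) / log (real DY) (real n))) < ereal (1 + \<epsilon>)"
    using lim e by (simp add: one_ereal_def)
  then have "eventually (\<lambda>n. ereal (real (length (BS n)) / log (real DY) (real n)) < ereal (1 + \<epsilon>)) sequentially"
    by (rule Limsup_lessD)
  then obtain n0 where n0: "\<And>n. n \<ge> n0 \<Longrightarrow> real (length (BS n)) / log (real DY) (real n) < 1 + \<epsilon>"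
    by (auto simp: eventually_sequentially)
  have lnDY: "ln (real DY) > 0" using DY by simp
  \<comment> \<open>\<open>C\<close> pays for the finitely many n that the limsup does not control.
    The cutoff is at least 2 so that ln n is positive beyond it.\<close>
  define C where "C = (\<Sum>n<max n0 2. real (length (BS n)) * ln (real DY))"
  show thesis
  proof
    show "C \<ge> 0" unfolding C_def using lnDY by (intro sum_nonneg) auto
  next
    fix n :: nat assume n: "n \<ge> 1"
    then have ln_n: "ln (real n) \<ge> 0" by simp
    show "real (length (BS n)) * ln (real DY) \<le> (1 + \<epsilon>) * ln (real n) + C"
    proof (cases "n < max n0 2")
      case True
      then have "real (length (BS n)) * ln (real DY) \<le> C"
        unfolding C_def using lnDY by (intro member_le_sum) auto
      then show ?thesis using ln_n e by (smt (verit) mult_nonneg_nonneg)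
    next
      case False
      then have "real (length (BS n)) / (ln (real n) / ln (real DY)) < 1 + \<epsilon>"
        using n0[of n] by (simp add: log_def)
      moreover have "ln (real n) > 0" using False by simp
      ultimately have "real (length (BS n)) * ln (real DY) < (1 + \<epsilon>) * ln (real n)"
        using lnDY by (simp add: field_simps)
      moreover have "C \<ge> 0" unfolding C_def using lnDY by (intro sum_nonneg) auto
      ultimately show ?thesis by simp
    qed
  qed
qed

text \<open>Each of the first j + 1 values in decreasing order is at least
  \<open>Q (xs ! j)\<close>, and together they sum to at most 1. This bounds the rank of an element
  by its inverse probability.\<close>

lemma decreasing_enumeration:
  fixes Q :: "'b \<Rightarrow> real"
  assumes fin: "finite V" and Q: "\<And>v. v \<in> V \<Longrightarrow> Q v \<ge> 0" and sum: "sum Q V \<le> 1"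
  obtains xs where "distinct xs" and "set xs = V"
    and "\<And>j. j < length xs \<Longrightarrow> real (j + 1) * Q (xs ! j) \<le> 1"
proof -
  obtain ys where ys: "set ys = V" "distinct ys"
    using finite_distinct_list[OF fin] by blast
  define xs where "xs = sort_key (\<lambda>v. - Q v) ys"
  have d: "distinct xs" and s: "set xs = V" using ys by (auto simp: xs_def)
  have "real (j + 1) * Q (xs ! j) \<le> 1" if j: "j < length xs" for j
  proof -
    have srt: "sorted (map (\<lambda>v. - Q v) xs)" by (simp add: xs_def)
    have "real (j + 1) * Q (xs ! j) = (\<Sum>i<j+1. Q (xs ! j))" by simp
    also have "\<dots> \<le> (\<Sum>i<j+1. Q (xs ! i))"
    proof (rule sum_mono)
      fix i assume "i \<in> {..<j+1}"
      then have "i \<le> j" by simp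
      then have "map (\<lambda>v. - Q v) xs ! i \<le> map (\<lambda>v. - Q v) xs ! j"
        using srt j by (intro sorted_nth_mono) auto
      then show "Q (xs ! j) \<le> Q (xs ! i)" using j \<open>i \<le> j\<close> by simp
    qed
    also have "\<dots> = sum Q ((!) xs ` {..<j+1})"
      using d j by (subst sum.reindex) (auto simp: inj_on_def nth_eq_iff_index_eq)
    also have "\<dots> \<le> sum Q V"
      using fin s j Q by (intro sum_mono2) auto
    finally show ?thesis using sum by simp
  qed
  with d s show thesis by (rule that)
qed

section \<open>Cutting a word into blocks and the resulting grammar\<close>

definition block :: "nat \<Rightarrow> 'b list \<Rightarrow> nat \<Rightarrow> 'b list" where
  "block k w t = take k (drop (t * k) w)"

lemma Suc_mult_le_of_less_div:
  assumes "t < n div k"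
  shows "Suc t * k \<le> (n::nat)"
proof -
  have "Suc t * k \<le> n div k * k" using assms by (intro mult_right_mono) auto
  also have "\<dots> \<le> n" by simp
  finally show ?thesis .
qed

lemma length_block: "t < length w div k \<Longrightarrow> length (block k w t) = k"
proof -
  assume "t < length w div k"
  then have "Suc t * k \<le> length w" by (rule Suc_mult_le_of_less_div)
  then show ?thesis by (simp add: block_def)
qed

lemma set_block: "set (block k w t) \<subseteq> set w"
  unfolding block_def by (meson order_trans set_drop_subset set_take_subset)

lemma concat_blocks:
  "concat (map (block k w) [0..<N]) = take (N * k) w"
proof (induction N)
  case (Suc N)
  have "take (N * k + k) w = take (N * k) w @ take k (drop (N * k) w)"
    by (rule take_add)
  then show ?case using Suc by (simp add: block_def add.commute)
qed simp

lemma length_concat_map_le: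
  assumes "\<And>s. s \<in> set xs \<Longrightarrow> length (f s) \<le> L"
  shows "length (concat (map f xs)) \<le> length xs * L"
  using assms by (induction xs) fastforce+

text \<open>The last summand accounts for everything but the nonterminals of the start rule.\<close>
lemma block_grammar:
  fixes w :: "nat list"
  assumes enc: "nat_encoder DY BS" and k: "k \<ge> 1" and w: "set w \<subseteq> {..<DX}"
    and dist: "distinct xs" and xs: "set xs = block k w ` {..<length w div k}"
    and idx: "\<And>t. t < length w div k \<Longrightarrow> idx t < length xs \<and> xs ! idx t = block k w t"
  obtains G where "inB DX G" and "generates DX G w"
    and "length (local_encoder DX BS G) \<le>
      (\<Sum>t<length w div k. length (BS (DX + 2 + idx t))) + (k + 1) * length (BS (DX + 1)) * (1 + length xs)"
proof
  define N where "N = length w div k"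
  \<comment> \<open>List index 0 of \<open>G\<close> holds the start rule A_1, so
    \<open>xs ! j\<close> stands at index j + 1 and is the body of A_(j+2).\<close>
  define u where "u = map (\<lambda>t. Non (idx t + 2)) [0..<N]"
  define tl where "tl = map Ter (drop (N * k) w)"
  define G where "G = (u @ tl) # map (map Ter) xs"
  note xs = xs[folded N_def] and idx = idx[folded N_def]
  let ?L = "length (BS (DX + 1))"
  have lenG: "length G = length xs + 1" by (simp add: G_def)
  have G0: "G ! 0 = u @ tl" by (simp add: G_def)
  have GS: "G ! Suc j = map Ter (xs ! j)" if "j < length xs" for j using that by (simp add: G_def)
  have x_len: "length x = k" and x_set: "set x \<subseteq> {..<DX}" if "x \<in> set xs" for x
    using that length_block[of _ w k] set_block[of k w] w by (auto simp: xs N_def)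
  have u_set: "set u = Non ` {2..length G}"
  proof
    show "set u \<subseteq> Non ` {2..length G}" using idx by (fastforce simp: u_def lenG)
  next
    \<comment> \<open>Every rule is used: its body is some block of w, and since \<open>xs\<close>
      is distinct, the index chosen for that block is the index of this rule.\<close>
    show "Non ` {2..length G} \<subseteq> set u"
    proof safe
      fix j assume j: "j \<in> {2..length G}"
      then have j': "j - 2 < length xs" by (auto simp: lenG)
      then have "xs ! (j - 2) \<in> block k w ` {..<N}" using xs nth_mem by blast
      then obtain t where t: "t < N" "xs ! (j - 2) = block k w t" by auto
      then have "j - 2 = idx t" using idx[of t] dist j' by (metis nth_eq_iff_index_eq)
      then show "Non j \<in> set u" using t j by (auto simp: u_def image_iff intro!: bexI[of _ t])
    qed
  qed
  have tl_set: "set tl \<subseteq> Ter ` {..<DX}"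
    using w set_drop_subset[of "N * k" w] by (auto simp: tl_def)
  have tl_len: "length tl < k" using k by (simp add: tl_def N_def minus_div_mult_eq_mod)
  show inB: "inB DX G"
  proof -
    have "length (G ! i) = k" "set (G ! i) \<subseteq> Ter ` {..<DX}" if i: "i \<in> {1..<length G}" for i
    proof -
      obtain j where j: "i = Suc j" "j < length xs" using i by (cases i) (auto simp: lenG)
      then have "xs ! j \<in> set xs" by simp
      from x_len[OF this] x_set[OF this] j
      show "length (G ! i) = k" "set (G ! i) \<subseteq> Ter ` {..<DX}" by (auto simp: GS)
    qed
    moreover have "G \<noteq> []" by (simp add: G_def)
    ultimately show ?thesis
      unfolding inB_def using k u_set tl_set tl_len G0 by blast
  qed
  have adm: "admissible DX G"
    unfolding admissible_def
  proof (intro conjI allI impI ballI)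
    show "G \<noteq> []" by (simp add: G_def)
  next
    fix i s assume i: "i < length G" and s: "s \<in> set (G ! i)"
    show "case s of Ter x \<Rightarrow> x < DX | Non j \<Rightarrow> i + 1 < j \<and> j \<le> length G"
    proof (cases i)
      case 0
      then show ?thesis using s u_set tl_set by (auto simp: G0)
    next
      case (Suc j)
      then have "j < length xs" using i lenG by simp
      with s x_set[of "xs ! j"] Suc show ?thesis by (auto simp: GS)
    qed
  qed
  \<comment> \<open>The body of a block rule is terminal, so any positive fuel expands it.\<close>
  have exp_rule: "expf (Suc f) G (Suc (Suc (idx t))) = block k w t" if "t < N" for t f
    using idx[OF that] by (simp add: GS comp_def)
  have "expf (length G) G 1 = w"
  proof -
    have ctl: "concat (map (\<lambda>s. case s of Ter x \<Rightarrow> [x] | Non j \<Rightarrow> f j) tl) = drop (N * k) w" for f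
      by (simp add: tl_def comp_def)
    have cu: "concat (map (\<lambda>s. case s of Ter x \<Rightarrow> [x] | Non j \<Rightarrow> expf (length xs) G j) u) = take (N * k) w"
    \<comment> \<open>After the start rule the remaining fuel is \<open>length xs\<close>, which is
      positive as soon as there is a block to expand.\<close>
    proof (cases "xs = []")
      case True
      then have "N = 0" using xs by auto
      then show ?thesis by (simp add: u_def)
    next
      case False
      then obtain f where f: "length xs = Suc f" by (cases xs) auto
      have "concat (map (\<lambda>s. case s of Ter x \<Rightarrow> [x] | Non j \<Rightarrow> expf (length xs) G j) u)
        = concat (map (block k w) [0..<N])"
        unfolding u_def map_map f
        by (intro arg_cong[of _ _ concat] map_cong refl) (simp add: exp_rule del: expf.simps)
      then show ?thesis by (simp add: concat_blocks)
    qed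
    show ?thesis by (simp add: lenG G0 ctl cu)
  qed
  then show "generates DX G w" using adm by (simp add: generates_def)
  have mono: "length (BS i) \<le> length (BS j)" if "i \<le> j" for i j
    using enc that by (auto simp: nat_encoder_def mono_def)
  define c where "c i = map (Fsym DX i) (G ! (i - 1)) @ [if i = length G then DX + 1 else DX]" for i
  define code where "code = (\<lambda>xs. concat (map BS xs))"
  have code_append: "code (xs @ ys) = code xs @ code ys" for xs ys by (simp add: code_def)
  have code_concat: "code (concat xss) = concat (map code xss)" for xss by (induction xss) (auto simp: code_def)
  \<comment> \<open>Terminals and separators are numbers up to \<open>DX + 1\<close>, so by monotone
    lengths each costs at most \<open>?L\<close>.\<close>
  have code_le: "length (code xs) \<le> length xs * ?L" if "\<And>x. x \<in> set xs \<Longrightarrow> x \<le> DX + 1" for xs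
    unfolding code_def using that by (intro length_concat_map_le mono) auto
  have BN: "BN DX G = concat (map c [1..<length G + 1])"
    by (simp only: BN_def c_def[abs_def])
  have "local_encoder DX BS G = code (concat (map c [1..<length G + 1]))"
    by (simp only: local_encoder_def BN code_def)
  then have enc_eq: "local_encoder DX BS G = concat (map (\<lambda>i. code (c i)) [1..<length G + 1])"
    by (simp only: code_concat map_map comp_def)
  have upt: "[1..<length G + 1] = 1 # [2..<length G + 1]"
    by (simp add: upt_conv_Cons numeral_2_eq_2 lenG del: upt_Suc)
  have split: "length (local_encoder DX BS G) = length (code (c 1)) +
      length (concat (map (\<lambda>i. code (c i)) [2..<length G + 1]))"
    unfolding enc_eq upt by simp
  have "length (concat (map (\<lambda>i. code (c i)) [2..<length G + 1]))
      \<le> length [2..<length G + 1] * ((k + 1) * ?L)"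
  proof (rule length_concat_map_le)
    fix i assume "i \<in> set [2..<length G + 1]"
    then obtain j where j: "i = j + 2" "j < length xs"
      by (auto simp: lenG intro: that[of "i - 2"])
    then have "xs ! j \<in> set xs" by simp
    from x_len[OF this] x_set[OF this] j
    have "length (c i) = k + 1" "\<And>x. x \<in> set (c i) \<Longrightarrow> x \<le> DX + 1"
      by (auto simp: c_def GS Fsym_def split: if_splits)
    then show "length (code (c i)) \<le> (k + 1) * ?L" using code_le by metis
  qed
  moreover have "length [2..<length G + 1] = length xs"
    by (simp add: lenG del: upt_Suc)
  ultimately have rest: "length (concat (map (\<lambda>i. code (c i)) [2..<length G + 1])) \<le> length xs * ((k + 1) * ?L)"
    by (simp only:)
  \<comment> \<open>In rule 1 the symbol \<open>Non (idx t + 2)\<close> has the relative code DX + 1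
    + (idx t + 2) - 1.\<close>
  have c1: "c 1 = map (\<lambda>t. DX + 2 + idx t) [0..<N] @ (map (Fsym DX 1) tl @ [if 1 = length G then DX + 1 else DX])"
    by (simp add: c_def G0 u_def Fsym_def)
  have "length (code (map (Fsym DX 1) tl @ [if 1 = length G then DX + 1 else DX])) \<le> (length tl + 1) * ?L"
  proof -
    have "x \<le> DX + 1" if "x \<in> set (map (Fsym DX 1) tl @ [if 1 = length G then DX + 1 else DX])" for x
      using that tl_set by (auto simp: Fsym_def split: if_splits)
    then have "length (code (map (Fsym DX 1) tl @ [if 1 = length G then DX + 1 else DX])) \<le>
        length (map (Fsym DX 1) tl @ [if 1 = length G then DX + 1 else DX]) * ?L"
      by (rule code_le)
    then show ?thesis by (simp only: length_append length_map list.size One_nat_def add_0)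
  qed
  also have "\<dots> \<le> (k + 1) * ?L" using tl_len by (intro mult_right_mono) auto
  finally have "length (code (c 1)) \<le> (\<Sum>t<N. length (BS (DX + 2 + idx t))) + (k + 1) * ?L"
    unfolding c1 code_append
    by (simp add: code_def length_concat comp_def interv_sum_list_conv_sum_set_nat atLeast0LessThan)
  with split rest show "length (local_encoder DX BS G) \<le>
      (\<Sum>t<length w div k. length (BS (DX + 2 + idx t))) + (k + 1) * ?L * (1 + length xs)"
    by (simp add: N_def algebra_simps)
qed

section \<open>Words of fixed length and the code length of block grammars\<close>

abbreviation words :: "nat \<Rightarrow> nat \<Rightarrow> nat list set" where
  "words D n \<equiv> {w. length w = n \<and> set w \<subseteq> {..<D}}"

lemma finite_words: "finite (words D n)"
  using finite_lists_length_eq[of "{..<D}" n] by (simp add: conj_commute)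

lemma card_words: "card (words D n) = D ^ n"
  using card_lists_length_eq[of "{..<D}" n] by (simp add: conj_commute)

lemma sum_words_Suc:
  "(\<Sum>w\<in>words D (Suc n). f w) = (\<Sum>w\<in>words D n. \<Sum>a<D. f (w @ [a]))"
proof -
  have "(\<Sum>w\<in>words D n. \<Sum>a<D. f (w @ [a])) = (\<Sum>(w, a)\<in>words D n \<times> {..<D}. f (w @ [a]))"
    by (rule sum.cartesian_product)
  also have "\<dots> = (\<Sum>w\<in>words D (Suc n). f w)"
  proof (rule sum.reindex_bij_witness[where i = "\<lambda>w. (butlast w, last w)" and j = "\<lambda>(w, a). w @ [a]"])
    fix w assume w: "w \<in> words D (Suc n)"
    then obtain v a where "w = v @ [a]" by (cases w rule: rev_cases) auto
    with w show "(butlast w, last w) \<in> words D n \<times> {..<D}"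
      "(case (butlast w, last w) of (w, a) \<Rightarrow> w @ [a]) = w"
      by auto
  qed auto
  finally show ?thesis by simp
qed

text \<open>Rules are numbered by decreasing \<open>Q\<close>, so rank is at most inverse
  probability and a reference to a block costs about its negative log probability. \<open>C\<close>
  is fixed before k, Q and w: it is paid once per block, so its share per letter vanishes as k
  grows.\<close>

lemma block_code_bound:
  assumes enc: "nat_encoder DY BS" and DY: "DY \<ge> 2"
    and lim: "limsup (\<lambda>n. ereal (real (length (BS n)) / log (real DY) (real n))) = 1"
    and \<epsilon>: "\<epsilon> > 0"
  obtains C where "C \<ge> 0" and
    "\<And>k Q w. k \<ge> 1 \<Longrightarrow> (\<And>v. v \<in> words DX k \<Longrightarrow> Q v \<ge> 0) \<Longrightarrow> sum Q (words DX k) \<le> 1 \<Longrightarrow>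
      set w \<subseteq> {..<DX} \<Longrightarrow> (\<And>t. t < length w div k \<Longrightarrow> Q (block k w t) > 0) \<Longrightarrow>
      \<exists>G. inB DX G \<and> generates DX G w \<and>
        real (length (local_encoder DX BS G)) * ln (real DY) \<le>
          (\<Sum>t<length w div k. (1 + \<epsilon>) * (- ln (Q (block k w t))) + C) +
          real ((k + 1) * length (BS (DX + 1)) * (1 + DX ^ k)) * ln (real DY)"
proof -
  obtain C0 where C0: "C0 \<ge> 0"
    "\<And>n. n \<ge> 1 \<Longrightarrow> real (length (BS n)) * ln (real DY) \<le> (1 + \<epsilon>) * ln (real n) + C0"
    using encoder_length_bound[OF DY lim \<epsilon>] by blast
  \<comment> \<open>The second summand pays for the offset in the code of the rule of index j,
    through DX + 2 + j \<le> (DX + 2)(j + 1).\<close>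
  define C where "C = C0 + (1 + \<epsilon>) * ln (real DX + 2)"
  have "C \<ge> 0" using C0 \<epsilon> by (simp add: C_def)
  then show thesis
  proof (rule that)
    fix k Q and w :: "nat list"
    assume k: "k \<ge> 1" and Q0: "\<And>v. v \<in> words DX k \<Longrightarrow> Q v \<ge> 0" and Q1: "sum Q (words DX k) \<le> (1::real)"
      and w: "set w \<subseteq> {..<DX}" and pos: "\<And>t. t < length w div k \<Longrightarrow> Q (block k w t) > 0"
    define N where "N = length w div k"
    define V where "V = block k w ` {..<N}"
    have V: "V \<subseteq> words DX k"
      using length_block[of _ w k] set_block[of k w] w by (fastforce simp: V_def N_def)
    have finV: "finite V" by (simp add: V_def)
    have "sum Q V \<le> 1"
      using sum_mono2[OF finite_words V, of Q] Q0 Q1 by auto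
    then obtain xs where xs: "distinct xs" "set xs = V"
      and rank: "\<And>j. j < length xs \<Longrightarrow> real (j + 1) * Q (xs ! j) \<le> 1"
      using decreasing_enumeration[OF finV, of Q] Q0 V by blast
    have "\<exists>j<length xs. xs ! j = block k w t" if "t < N" for t
      using that xs(2) by (metis V_def in_set_conv_nth imageI lessThan_iff)
    then obtain idx where idx: "\<And>t. t < N \<Longrightarrow> idx t < length xs \<and> xs ! idx t = block k w t"
      by metis
    obtain G where G: "inB DX G" "generates DX G w" and len:
      "length (local_encoder DX BS G) \<le>
      (\<Sum>t<N. length (BS (DX + 2 + idx t))) + (k + 1) * length (BS (DX + 1)) * (1 + length xs)"
      using block_grammar[OF enc k w xs(1), of idx] xs(2) idx unfolding V_def N_def by blast
    \<comment> \<open>The rule bodies are distinct words of length k, so their number is bounded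
      independently of the length of w.\<close>
    have "length xs \<le> DX ^ k"
      using card_mono[OF finite_words V] xs by (simp add: card_words distinct_card[symmetric])
    then have len': "length (local_encoder DX BS G) \<le>
      (\<Sum>t<N. length (BS (DX + 2 + idx t))) + (k + 1) * length (BS (DX + 1)) * (1 + DX ^ k)"
      using len by (meson add_left_mono mult_left_mono le0 order_trans)
    have lnDY: "ln (real DY) \<ge> 0" using DY by simp
    have sym: "real (length (BS (DX + 2 + idx t))) * ln (real DY) \<le> (1 + \<epsilon>) * (- ln (Q (block k w t))) + C"
      if t: "t < N" for t
    proof -
      let ?q = "Q (block k w t)"
      have q: "?q > 0" using pos t by (simp add: N_def)
      have "real (idx t + 1) * ?q \<le> 1" using rank idx[OF t] by metis
      then have "real (idx t + 1) \<le> 1 / ?q" using q by (simp add: field_simps)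
      then have "ln (real (idx t + 1)) \<le> ln (1 / ?q)" by (intro ln_mono) auto
      also have "\<dots> = - ln ?q" using q by (simp add: ln_div)
      finally have r: "ln (real (idx t + 1)) \<le> - ln ?q" .
      have "real (DX + 2 + idx t) \<le> (real DX + 2) * real (idx t + 1)"
        by (simp add: algebra_simps)
      then have "ln (real (DX + 2 + idx t)) \<le> ln ((real DX + 2) * real (idx t + 1))"
        by (intro ln_mono) auto
      also have "\<dots> = ln (real DX + 2) + ln (real (idx t + 1))" by (rule ln_mult_pos) auto
      finally have "ln (real (DX + 2 + idx t)) \<le> ln (real DX + 2) - ln ?q" using r by simp
      then have "(1 + \<epsilon>) * ln (real (DX + 2 + idx t)) \<le> (1 + \<epsilon>) * (ln (real DX + 2) - ln ?q)"
        using \<epsilon> by (intro mult_left_mono) auto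
      then show ?thesis
        using C0(2)[of "DX + 2 + idx t"] by (simp add: C_def algebra_simps)
    qed
    have "real (length (local_encoder DX BS G)) * ln (real DY) \<le>
        real ((\<Sum>t<N. length (BS (DX + 2 + idx t))) + (k + 1) * length (BS (DX + 1)) * (1 + DX ^ k)) * ln (real DY)"
      using len' lnDY by (intro mult_right_mono) (simp_all only: of_nat_le_iff)
    also have "\<dots> = (\<Sum>t<N. real (length (BS (DX + 2 + idx t))) * ln (real DY)) +
          real ((k + 1) * length (BS (DX + 1)) * (1 + DX ^ k)) * ln (real DY)"
      by (simp only: of_nat_add of_nat_sum distrib_right sum_distrib_right)
    also have "\<dots> \<le> (\<Sum>t<N. (1 + \<epsilon>) * (- ln (Q (block k w t))) + C) +
          real ((k + 1) * length (BS (DX + 1)) * (1 + DX ^ k)) * ln (real DY)"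
      by (intro add_right_mono sum_mono sym) auto
    finally show "\<exists>G. inB DX G \<and> generates DX G w \<and>
        real (length (local_encoder DX BS G)) * ln (real DY) \<le>
          (\<Sum>t<length w div k. (1 + \<epsilon>) * (- ln (Q (block k w t))) + C) +
          real ((k + 1) * length (BS (DX + 1)) * (1 + DX ^ k)) * ln (real DY)"
      using G unfolding N_def by blast
  qed
qed

section \<open>Markov weights of blocks\<close>

text \<open>The order-m Markov approximation of p, started from the uniform distribution.\<close>
definition markov_weight :: "nat \<Rightarrow> (nat list \<Rightarrow> real) \<Rightarrow> nat \<Rightarrow> nat list \<Rightarrow> real" where
  "markov_weight D p m b =
     (1 / real D) ^ m * (\<Prod>i<length b - m. p (take (Suc m) (drop i b)) / p (take m (drop i b)))"

lemma markov_weight_nonneg: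
  assumes "\<And>v. p v \<ge> 0"
  shows "markov_weight D p m b \<ge> 0"
  unfolding markov_weight_def using assms by (intro mult_nonneg_nonneg prod_nonneg) auto

text \<open>Here \<open>drop d b\<close> consists of the last m letters of b, the context of the
  appended letter, and only the window ending in that letter is new.\<close>

lemma markov_weight_snoc:
  assumes "length b = m + d"
  shows "markov_weight D p m (b @ [a]) = markov_weight D p m b * (p (drop d b @ [a]) / p (drop d b))"
proof -
  have "p (take (Suc m) (drop i (b @ [a]))) / p (take m (drop i (b @ [a]))) =
      p (take (Suc m) (drop i b)) / p (take m (drop i b))" if "i < d" for i
    using that assms by simp
  then show ?thesis using assms by (simp add: markov_weight_def)
qed

text \<open>Summing out the last letter multiplies each weight by the total conditional weight of
  its context, at most 1 by \<open>sub\<close>. The base case is the uniform distribution on words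
  of length m.\<close>

lemma sum_markov_weight_le_1:
  assumes D: "D \<ge> 1" and p: "\<And>v. p v \<ge> 0" and sub: "\<And>u. u \<in> words D m \<Longrightarrow> (\<Sum>a<D. p (u @ [a])) \<le> p u"
  shows "sum (markov_weight D p m) (words D (m + d)) \<le> 1"
proof (induction d)
  case 0
  have "sum (markov_weight D p m) (words D m) = (\<Sum>b\<in>words D m. (1 / real D) ^ m)"
    by (intro sum.cong) (auto simp: markov_weight_def)
  then show ?case using D by (simp add: card_words power_divide)
next
  case (Suc d)
  have "sum (markov_weight D p m) (words D (m + Suc d)) =
      (\<Sum>b\<in>words D (m + d). \<Sum>a<D. markov_weight D p m (b @ [a]))"
    using sum_words_Suc[where D = D and n = "m + d"] by simp
  also have "\<dots> \<le> (\<Sum>b\<in>words D (m + d). markov_weight D p m b)"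
  proof (rule sum_mono)
    fix b assume b: "b \<in> words D (m + d)"
    have "drop d b \<in> words D m" using b set_drop_subset[of d b] by auto
    \<comment> \<open>If the context has weight 0, the quotient is 0 by the convention for division
      by zero.\<close>
    then have "(\<Sum>a<D. p (drop d b @ [a])) / p (drop d b) \<le> 1"
      using sub[of "drop d b"] p[of "drop d b"] by (cases "p (drop d b) = 0") (auto simp: field_simps)
    moreover have "(\<Sum>a<D. markov_weight D p m (b @ [a]))
        = markov_weight D p m b * ((\<Sum>a<D. p (drop d b @ [a])) / p (drop d b))"
      using b by (simp add: markov_weight_snoc[of b m d] sum_distrib_left sum_divide_distrib)
    ultimately show "(\<Sum>a<D. markov_weight D p m (b @ [a])) \<le> markov_weight D p m b"
      using markov_weight_nonneg[where p = p and D = D and m = m and b = b, OF p] by (metis mult_left_le)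
  qed
  finally show ?case using Suc by simp
qed

lemma ln_markov_weight:
  assumes D: "D \<ge> 1" and "\<And>i. i + m < length b \<Longrightarrow> p (take (Suc m) (drop i b)) > 0 \<and> p (take m (drop i b)) > 0"
  shows "markov_weight D p m b > 0"
    and "- ln (markov_weight D p m b) = real m * ln (real D) +
      (\<Sum>i<length b - m. ln (p (take m (drop i b))) - ln (p (take (Suc m) (drop i b))))"
proof -
  let ?r = "\<lambda>i. p (take (Suc m) (drop i b)) / p (take m (drop i b))"
  have r: "?r i > 0" if "i \<in> {..<length b - m}" for i using assms(2)[of i] that by auto
  then have r0: "?r i \<noteq> 0" if "i \<in> {..<length b - m}" for i using that by (metis less_irrefl)
  from r have pr: "(\<Prod>i<length b - m. ?r i) > 0" by (rule prod_pos)
  then show "markov_weight D p m b > 0" using D by (simp add: markov_weight_def)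
  have "ln (markov_weight D p m b) = ln ((1 / real D) ^ m) + ln (\<Prod>i<length b - m. ?r i)"
    unfolding markov_weight_def using D pr by (intro ln_mult_pos) auto
  also have "ln (\<Prod>i<length b - m. ?r i) = (\<Sum>i<length b - m. ln (?r i))"
    by (rule ln_prod) (use r0 in simp_all)
  also have "\<dots> = (\<Sum>i<length b - m. ln (p (take (Suc m) (drop i b))) - ln (p (take m (drop i b))))"
  proof (rule sum.cong)
    fix i assume "i \<in> {..<length b - m}"
    then show "ln (?r i) = ln (p (take (Suc m) (drop i b))) - ln (p (take m (drop i b)))"
      using assms(2)[of i] by (intro ln_divide_pos) auto
  qed simp
  also have "ln ((1 / real D) ^ m) = - real m * ln (real D)"
    using D by (simp add: ln_realpow ln_div)
  finally show "- ln (markov_weight D p m b) = real m * ln (real D) +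
      (\<Sum>i<length b - m. ln (p (take m (drop i b))) - ln (p (take (Suc m) (drop i b))))"
    by (simp add: sum_subtractf)
qed

text \<open>Nonoverlapping blocks use each window of the word at most once, so that nonnegativity of the
  window costs g bounds the cost of all blocks by a sum over all positions.\<close>
lemma sum_ln_markov_weight_blocks:
  assumes D: "D \<ge> 1" and k: "m < k" and g: "\<And>s. g s \<ge> 0"
    and win: "\<And>s. s + m < length w \<Longrightarrow> p (take (Suc m) (drop s w)) > 0 \<and> p (take m (drop s w)) > 0 \<and>
        g s = ln (p (take m (drop s w))) - ln (p (take (Suc m) (drop s w)))"
  shows "t < length w div k \<Longrightarrow> markov_weight D p m (block k w t) > 0"
    and "(\<Sum>t<length w div k. - ln (markov_weight D p m (block k w t))) \<le>
      real (length w div k) * (real m * ln (real D)) + (\<Sum>s<length w. g s)"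
proof -
  \<comment> \<open>A window inside a block is a window of the whole word.\<close>
  have bw: "take l (drop i (block k w t)) = take l (drop (t * k + i) w)" if "i + l \<le> k" for i l t
    using that by (simp add: block_def drop_take add.commute min_def)
  have tk: "t * k + i < length w - m" if "t < length w div k" "i + m < k" for t i
  proof -
    have "Suc t * k \<le> length w" using that(1) by (rule Suc_mult_le_of_less_div)
    then show ?thesis using that(2) by simp
  qed
  have pos: "p (take (Suc m) (drop i (block k w t))) > 0 \<and> p (take m (drop i (block k w t))) > 0"
    and cost: "ln (p (take m (drop i (block k w t)))) - ln (p (take (Suc m) (drop i (block k w t)))) = g (t * k + i)"
    if t: "t < length w div k" and i: "i + m < length (block k w t)" for t i
  proof -
    have i': "i + m < k" using i length_block[OF t] by (simp only:)
    then have *: "take (Suc m) (drop i (block k w t)) = take (Suc m) (drop (t * k + i) w)"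
      "take m (drop i (block k w t)) = take m (drop (t * k + i) w)"
      using bw[of i "Suc m" t] bw[of i m t] by simp_all
    have "t * k + i + m < length w" using tk[OF t i'] by linarith
    from win[OF this] show "p (take (Suc m) (drop i (block k w t))) > 0 \<and> p (take m (drop i (block k w t))) > 0"
      "ln (p (take m (drop i (block k w t)))) - ln (p (take (Suc m) (drop i (block k w t)))) = g (t * k + i)"
      unfolding * by auto
  qed
  show "markov_weight D p m (block k w t) > 0" if "t < length w div k" for t
    using ln_markov_weight(1)[OF D] pos[OF that] by blast
  have "- ln (markov_weight D p m (block k w t)) \<le> real m * ln (real D) + sum g {t * k..<t * k + k}"
    if t: "t < length w div k" for t
  proof -
    have "- ln (markov_weight D p m (block k w t)) = real m * ln (real D) + (\<Sum>i<k - m. g (t * k + i))"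
    proof -
      have "- ln (markov_weight D p m (block k w t)) = real m * ln (real D) + (\<Sum>i<length (block k w t) - m.
          ln (p (take m (drop i (block k w t)))) - ln (p (take (Suc m) (drop i (block k w t)))))"
        by (rule ln_markov_weight(2)[OF D]) (rule pos[OF t])
      also have "(\<Sum>i<length (block k w t) - m.
          ln (p (take m (drop i (block k w t)))) - ln (p (take (Suc m) (drop i (block k w t))))) = (\<Sum>i<k - m. g (t * k + i))"
        unfolding length_block[OF t]
      proof (rule sum.cong[OF refl])
        fix i assume "i \<in> {..<k - m}"
        then have "i + m < length (block k w t)" using length_block[OF t] by auto
        with t show "ln (p (take m (drop i (block k w t)))) - ln (p (take (Suc m) (drop i (block k w t)))) = g (t * k + i)"
          by (rule cost)
      qed
      finally show ?thesis .
    qed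
    \<comment> \<open>Adding the costs of the m windows that cross the end of the block gives one
      cost per position of the block; these ranges then tile an initial segment of the word.\<close>
    also have "(\<Sum>i<k - m. g (t * k + i)) \<le> (\<Sum>i<k. g (t * k + i))"
      using g by (intro sum_mono2) auto
    also have "(\<Sum>i<k. g (t * k + i)) = sum g {t * k..<t * k + k}"
      using sum.shift_bounds_nat_ivl[of g 0 "t * k" k] by (simp add: add.commute atLeast0LessThan)
    finally show ?thesis by simp
  qed
  then have "(\<Sum>t<length w div k. - ln (markov_weight D p m (block k w t))) \<le>
      (\<Sum>t<length w div k. real m * ln (real D) + sum g {t * k..<t * k + k})"
    by (intro sum_mono) auto
  also have "\<dots> = real (length w div k) * (real m * ln (real D)) + (\<Sum>s<length w div k * k. g s)"
    by (simp add: sum.distrib sum.nat_group)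
  also have "(\<Sum>s<length w div k * k. g s) \<le> (\<Sum>s<length w. g s)"
    using g by (intro sum_mono2) auto
  finally show "(\<Sum>t<length w div k. - ln (markov_weight D p m (block k w t))) \<le>
      real (length w div k) * (real m * ln (real D)) + (\<Sum>s<length w. g s)" by simp
qed

section \<open>Finite-alphabet stationary processes\<close>

text \<open>The offset 1 makes \<open>window 0 n\<close> of a path the string X_1, ..., X_n, in
  agreement with \<open>block_prob\<close>.\<close>

definition window :: "nat \<Rightarrow> nat \<Rightarrow> (int \<Rightarrow> 'b) \<Rightarrow> 'b list" where
  "window s l f = map (\<lambda>j. f (int s + int j + 1)) [0..<l]"

lemma length_window [simp]: "length (window s l f) = l"
  by (simp add: window_def)

lemma nth_window: "j < l \<Longrightarrow> window s l f ! j = f (int s + int j + 1)"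
  by (simp add: window_def)

lemma window_Suc: "window s (Suc l) f = window s l f @ [f (int s + int l + 1)]"
  by (simp add: window_def)

lemma take_drop_window: "i + l \<le> n \<Longrightarrow> take l (drop i (window s n f)) = window (s + i) l f"
  by (rule nth_equalityI) (auto simp: nth_window algebra_simps)

lemma window_shift: "window s l (\<lambda>i. f (i + int t)) = window (s + t) l f"
  by (simp add: window_def algebra_simps)

abbreviation path_algebra :: "(int \<Rightarrow> nat) measure" where
  "path_algebra \<equiv> PiM UNIV (\<lambda>_. count_space UNIV)"

lemma space_path_algebra: "space path_algebra = UNIV"
  by (simp add: space_PiM)

lemma sets_window_eq: "{f. window s l f = v} \<in> sets path_algebra"
proof -
  have "{f \<in> space path_algebra. \<forall>j<l. f (int s + int j + 1) = v ! j} \<in> sets path_algebra"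
    by measurable
  moreover have "{f. window s l f = v} =
      (if length v = l then {f \<in> space path_algebra. \<forall>j<l. f (int s + int j + 1) = v ! j} else {})"
    by (auto simp: space_path_algebra list_eq_iff_nth_eq nth_window)
  ultimately show ?thesis by simp
qed

lemma measurable_window [measurable]: "window s l \<in> measurable path_algebra (count_space UNIV)"
  using sets_window_eq[of s l]
  by (subst measurable_count_space_eq_countable)
     (auto simp: space_path_algebra vimage_def)

lemma measurable_shift [measurable]: "(\<lambda>f i. f (i + t)) \<in> measurable path_algebra path_algebra"
  by (rule measurable_PiM_single') (auto simp: space_PiM)

lemma funpow_shift: "((\<lambda>f i. f (i + 1)) ^^ n) f = (\<lambda>i. f (i + int n))"
proof (induction n)
  case (Suc n)
  have "i + 1 + int n = i + int (Suc n)" for i by simp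
  then show ?case unfolding funpow.simps comp_apply Suc by (simp only:)
qed simp

section \<open>Path law and window probabilities\<close>

locale finite_process = prob_space M for M :: "'a measure" +
  fixes D :: nat and X :: "int \<Rightarrow> 'a \<Rightarrow> nat"
  assumes measurable_X [measurable]: "X k \<in> measurable M (count_space UNIV)"
    and X_less: "\<omega> \<in> space M \<Longrightarrow> X k \<omega> < D"
    and stationary: "stationary_process M X"
begin

abbreviation (input) path :: "'a \<Rightarrow> int \<Rightarrow> nat" where "path \<omega> \<equiv> \<lambda>i. X i \<omega>"

abbreviation path_law :: "(int \<Rightarrow> nat) measure" where "path_law \<equiv> distr M path_algebra path"

lemma measurable_path [measurable]: "path \<in> measurable M path_algebra"
proof (rule measurable_PiM_single')
  show "X i \<in> measurable M (count_space UNIV)" for i by (rule measurable_X)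
  show "(\<lambda>\<omega> i. X i \<omega>) \<in> space M \<rightarrow> (\<Pi>\<^sub>E i\<in>UNIV. space (count_space UNIV))"
    by simp
qed

lemma measurable_window_path [measurable]: "(\<lambda>\<omega>. window s l (path \<omega>)) \<in> measurable M (count_space UNIV)"
  by measurable

lemma window_in_words: "\<omega> \<in> space M \<Longrightarrow> window s l (path \<omega>) \<in> words D l"
  using X_less by (auto simp: window_def)

lemma path_law_shift: "distr path_law path_law (\<lambda>f i. f (i + t)) = path_law"
proof -
  have "distr path_law path_law (\<lambda>f i. f (i + t)) = distr path_law path_algebra (\<lambda>f i. f (i + t))"
    by (rule distr_cong) auto
  also have "\<dots> = distr M path_algebra (\<lambda>\<omega> i. X (i + t) \<omega>)"
    by (subst distr_distr) (auto simp: comp_def)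
  also have "\<dots> = path_law"
    using stationary by (simp add: stationary_process_def)
  finally show ?thesis .
qed

lemma prob_window: "prob {\<omega>\<in>space M. window s (length v) (path \<omega>) = v} = block_prob M X v"
proof -
  have S: "{f. window 0 (length v) f = v} \<in> sets path_algebra" by (rule sets_window_eq)
  have "prob {\<omega>\<in>space M. window s (length v) (path \<omega>) = v} =
      prob ((\<lambda>\<omega> i. X (i + int s) \<omega>) -` {f. window 0 (length v) f = v} \<inter> space M)"
    by (intro arg_cong[of _ _ prob]) (auto simp: window_shift[of 0 _ "path _" s, simplified])
  also have "\<dots> = measure (distr M path_algebra (\<lambda>\<omega> i. X (i + int s) \<omega>)) {f. window 0 (length v) f = v}"
    using S by (subst measure_distr) (auto intro!: measurable_PiM_single' simp: space_PiM)
  also have "\<dots> = measure path_law {f. window 0 (length v) f = v}"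
    using stationary by (simp add: stationary_process_def)
  also have "\<dots> = prob (path -` {f. window 0 (length v) f = v} \<inter> space M)"
    using S by (subst measure_distr) auto
  also have "\<dots> = block_prob M X v"
    unfolding block_prob_def
    by (intro arg_cong[of _ _ prob]) (auto simp: list_eq_iff_nth_eq nth_window add.commute)
  finally show ?thesis .
qed

lemma block_prob_nonneg: "block_prob M X v \<ge> 0"
  by (simp add: block_prob_def)

text \<open>The one-letter extensions of u are disjoint events inside the event of u. This supplies
  the hypothesis \<open>sub\<close> of \<open>sum_markov_weight_le_1\<close>.\<close>

lemma sum_block_prob_snoc: "(\<Sum>a<D. block_prob M X (u @ [a])) \<le> block_prob M X u"
proof -
  let ?A = "\<lambda>a. {\<omega>\<in>space M. window 0 (length (u @ [a])) (path \<omega>) = u @ [a]}"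
  have "(\<Sum>a<D. block_prob M X (u @ [a])) = (\<Sum>a<D. prob (?A a))"
    by (intro sum.cong prob_window[symmetric] refl)
  also have "\<dots> = prob (\<Union>a<D. ?A a)"
    by (intro finite_measure_finite_Union[symmetric]) (auto simp: disjoint_family_on_def)
  also have "\<dots> \<le> prob {\<omega>\<in>space M. window 0 (length u) (path \<omega>) = u}"
    by (intro finite_measure_mono) (auto simp: window_Suc)
  finally show ?thesis by (simp add: prob_window)
qed

lemma block_prob_snoc_le: "block_prob M X (u @ [a]) \<le> block_prob M X u"
proof -
  have "prob {\<omega>\<in>space M. window 0 (length (u @ [a])) (path \<omega>) = u @ [a]} \<le>
      prob {\<omega>\<in>space M. window 0 (length u) (path \<omega>) = u}"
    by (intro finite_measure_mono) (auto simp: window_Suc)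
  then show ?thesis by (simp only: prob_window)
qed

text \<open>A word of probability 0 almost surely does not occur at a given position, and there are
  countably many words and positions. Along almost every path, all logarithms below are thus taken
  of positive numbers.\<close>

lemma AE_block_prob_window_pos: "AE \<omega> in M. \<forall>s l. block_prob M X (window s l (path \<omega>)) > 0"
proof -
  have "AE \<omega> in M. block_prob M X v = 0 \<longrightarrow> window s (length v) (path \<omega>) \<noteq> v" for s v
  proof (cases "block_prob M X v = 0")
    case True
    then have "prob {\<omega>\<in>space M. window s (length v) (path \<omega>) = v} = 0"
      by (simp add: prob_window)
    moreover have "{\<omega>\<in>space M. window s (length v) (path \<omega>) = v} \<in> events" by measurable
    ultimately have "AE \<omega> in M. \<omega> \<notin> {\<omega>\<in>space M. window s (length v) (path \<omega>) = v}"
      using prob_eq_0 by blast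
    then show ?thesis by (auto elim!: AE_mp)
  qed simp
  then have "AE \<omega> in M. \<forall>s v. block_prob M X v = 0 \<longrightarrow> window s (length v) (path \<omega>) \<noteq> v"
    by (simp add: AE_all_countable)
  then show ?thesis
  proof eventually_elim
    case (elim \<omega>)
    then show ?case
    proof (intro allI)
      fix s l
      have "block_prob M X (window s l (path \<omega>)) \<noteq> 0"
        using elim[rule_format, of "window s l (path \<omega>)" s] by auto
      then show "block_prob M X (window s l (path \<omega>)) > 0"
        using block_prob_nonneg[of "window s l (path \<omega>)"] by linarith
    qed
  qed
qed

text \<open>The window takes values in the finite set \<open>words D l\<close>, so the function is a
  finite combination of indicators of the events that the window equals v.\<close>

lemma
  fixes \<phi> :: "nat list \<Rightarrow> real"
  shows integrable_window: "integrable M (\<lambda>\<omega>. \<phi> (window s l (path \<omega>)))"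
    and integral_window: "(\<integral>\<omega>. \<phi> (window s l (path \<omega>)) \<partial>M) = (\<Sum>v\<in>words D l. block_prob M X v * \<phi> v)"
proof -
  let ?A = "\<lambda>v. {\<omega>\<in>space M. window s (length v) (path \<omega>) = v}"
  have eq: "\<phi> (window s l (path \<omega>)) = (\<Sum>v\<in>words D l. \<phi> v * indicator (?A v) \<omega>)"
    if \<omega>: "\<omega> \<in> space M" for \<omega>
  proof -
    have "(\<Sum>v\<in>words D l. \<phi> v * indicator (?A v) \<omega>) =
        (\<Sum>v\<in>words D l. if v = window s l (path \<omega>) then \<phi> v else 0)"
      using \<omega> by (intro sum.cong) (auto simp: indicator_def)
    also have "\<dots> = \<phi> (window s l (path \<omega>))"
      using window_in_words[OF \<omega>, of s l] finite_words[of l D] by (subst sum.delta) auto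
    finally show ?thesis by simp
  qed
  have iA: "integrable M (\<lambda>\<omega>. \<phi> v * indicator (?A v) \<omega>)" for v
    by (intro integrable_mult_right integrable_real_indicator) (auto simp: emeasure_eq_measure)
  have "integrable M (\<lambda>\<omega>. \<Sum>v\<in>words D l. \<phi> v * indicator (?A v) \<omega>)"
    by (intro Bochner_Integration.integrable_sum iA)
  then show "integrable M (\<lambda>\<omega>. \<phi> (window s l (path \<omega>)))"
    by (subst Bochner_Integration.integrable_cong[OF refl eq])
  have "(\<integral>\<omega>. \<phi> (window s l (path \<omega>)) \<partial>M) = (\<integral>\<omega>. (\<Sum>v\<in>words D l. \<phi> v * indicator (?A v) \<omega>) \<partial>M)"
    by (rule Bochner_Integration.integral_cong[OF refl eq])
  also have "\<dots> = (\<Sum>v\<in>words D l. \<integral>\<omega>. \<phi> v * indicator (?A v) \<omega> \<partial>M)"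
    by (rule Bochner_Integration.integral_sum) (rule iA)
  also have "\<dots> = (\<Sum>v\<in>words D l. block_prob M X v * \<phi> v)"
  proof (rule sum.cong[OF refl])
    fix v
    have "(\<integral>\<omega>. \<phi> v * indicator (?A v) \<omega> \<partial>M) = \<phi> v * prob (?A v \<inter> space M)"
      by simp
    also have "?A v \<inter> space M = ?A v" by auto
    finally show "(\<integral>\<omega>. \<phi> v * indicator (?A v) \<omega> \<partial>M) = block_prob M X v * \<phi> v"
      by (simp only: prob_window mult.commute)
  qed
  finally show "(\<integral>\<omega>. \<phi> (window s l (path \<omega>)) \<partial>M) = (\<Sum>v\<in>words D l. block_prob M X v * \<phi> v)" .
qed

section \<open>Conditional information along a path\<close>

text \<open>The negative log conditional probability of the letter at s + m + 1 given the m letters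
  before it.\<close>

definition cond_info :: "nat \<Rightarrow> nat \<Rightarrow> (int \<Rightarrow> nat) \<Rightarrow> real" where
  "cond_info m s f = ln (block_prob M X (window s m f)) - ln (block_prob M X (window s (Suc m) f))"

lemma integrable_cond_info: "integrable M (\<lambda>\<omega>. cond_info m s (path \<omega>))"
  unfolding cond_info_def
  using integrable_window[of "\<lambda>v. ln (block_prob M X v)"] by (intro Bochner_Integration.integrable_diff)

lemma integral_cond_info:
  "(\<integral>\<omega>. cond_info m s (path \<omega>) \<partial>M) = block_entropy D M X (Suc m) - block_entropy D M X m"
  unfolding cond_info_def block_entropy_def
  using integrable_window[of "\<lambda>v. ln (block_prob M X v)"] integral_window[of "\<lambda>v. ln (block_prob M X v)"]
  by (subst Bochner_Integration.integral_diff) auto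

text \<open>The function \<open>cond_info m 0\<close> minus c has negative mean under the path law,
  so its Birkhoff sums along the ergodic shift are almost surely bounded above.\<close>

lemma AE_sum_cond_info_le:
  assumes erg: "ergodic_process M X"
    and c: "block_entropy D M X (Suc m) - block_entropy D M X m < c"
  shows "AE \<omega> in M. \<exists>K. \<forall>n. (\<Sum>s<n. cond_info m s (path \<omega>)) \<le> real n * c + K"
proof -
  let ?F = "\<lambda>f. cond_info m 0 f - c"
  let ?T = "\<lambda>(f :: int \<Rightarrow> nat) i. f (i + 1)"
  have F_meas [measurable]: "?F \<in> borel_measurable path_algebra"
    unfolding cond_info_def by measurable
  have F_int: "integrable path_law ?F"
    by (subst integrable_distr_eq) (auto intro: integrable_cond_info)
  have "AE f in path_law. \<exists>K. \<forall>n. (\<Sum>i<n. ?F ((?T ^^ i) f)) \<le> K"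
  proof (rule birkhoff_sums_bounded_above)
    show "prob_space path_law" by (rule prob_space_distr) simp
    show "?T \<in> measurable path_law path_law" by simp
    show "distr path_law path_law ?T = path_law" by (rule path_law_shift)
    show "integrable path_law ?F" by (rule F_int)
    have "(\<integral>f. ?F f \<partial>path_law) = (\<integral>\<omega>. ?F (path \<omega>) \<partial>M)"
      by (rule integral_distr) auto
    also have "\<dots> = block_entropy D M X (Suc m) - block_entropy D M X m - c"
      using integrable_cond_info[of m 0] by (simp add: integral_cond_info prob_space)
    finally show "(\<integral>f. ?F f \<partial>path_law) < 0" using c by simp
  next
    fix S assume S: "S \<in> sets path_law" and inv: "\<forall>f\<in>space path_law. f \<in> S \<longleftrightarrow> ?T f \<in> S"
    have law: "measure path_law S = measure M {\<omega>\<in>space M. path \<omega> \<in> S}"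
      using S by (subst measure_distr) (auto intro: arg_cong[of _ _ prob])
    have "\<forall>f. f \<in> S \<longleftrightarrow> ?T f \<in> S"
      using inv unfolding space_distr space_path_algebra by blast
    moreover have "S \<in> sets path_algebra" using S by simp
    ultimately have "measure M {\<omega>\<in>space M. path \<omega> \<in> S} = 0 \<or> measure M {\<omega>\<in>space M. path \<omega> \<in> S} = 1"
      using erg[unfolded ergodic_process_def, rule_format, of S] by blast
    then show "measure path_law S = 0 \<or> measure path_law S = 1"
      by (simp only: law)
  qed
  then have "AE \<omega> in M. \<exists>K. \<forall>n. (\<Sum>i<n. ?F ((?T ^^ i) (path \<omega>))) \<le> K"
    by (rule AE_distrD[rotated]) simp
  then show ?thesis
  proof eventually_elim
    case (elim \<omega>)
    \<comment> \<open>Shifting the path i times moves the window from position 0 to position i, so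
      the Birkhoff sum is a sum over positions of one path.\<close>
    have "window 0 l ((?T ^^ i) (path \<omega>)) = window i l (path \<omega>)" for i l
      unfolding funpow_shift using window_shift[of 0 l "path \<omega>" i] by (simp only: add_0)
    then have "cond_info m 0 ((?T ^^ i) (path \<omega>)) = cond_info m i (path \<omega>)" for i
      by (simp only: cond_info_def)
    then have *: "(\<Sum>i<n. ?F ((?T ^^ i) (path \<omega>))) = (\<Sum>s<n. cond_info m s (path \<omega>)) - real n * c" for n
      by (simp only: sum_subtractf sum_constant card_lessThan)
    from elim obtain K where "(\<Sum>i<n. ?F ((?T ^^ i) (path \<omega>))) \<le> K" for n by blast
    then have "(\<Sum>s<n. cond_info m s (path \<omega>)) \<le> real n * c + K" for n
      unfolding * by (metis add.commute diff_le_eq)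
    then show ?case by blast
  qed
qed

text \<open>If every increment were at least c, the block entropies would grow at least linearly
  with slope c, forcing c \<le> h.\<close>

lemma exists_small_entropy_increment:
  assumes lim: "(\<lambda>n. block_entropy D M X n / real n) \<longlonglongrightarrow> h" and "h < c"
  shows "\<exists>m. block_entropy D M X (Suc m) - block_entropy D M X m < c"
proof (rule ccontr)
  let ?H = "block_entropy D M X"
  assume "\<not> ?thesis"
  then have step: "?H (Suc m) \<ge> ?H m + c" for m by (simp add: not_less algebra_simps)
  have H: "?H n \<ge> ?H 0 + real n * c" for n
  proof (induction n)
    case (Suc n)
    then show ?case using step[of n] by (simp add: distrib_right)
  qed simp
  have "(\<lambda>n. ?H 0 / real n + c) \<longlonglongrightarrow> 0 + c"
    by (rule tendsto_add[OF lim_const_over_n tendsto_const])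
  then have "0 + c \<le> h"
  proof (rule LIMSEQ_le[OF _ lim], intro exI[of _ 1] allI impI)
    fix n :: nat assume "n \<ge> 1"
    then show "?H 0 / real n + c \<le> ?H n / real n"
      using divide_right_mono[OF H[of n], of "real n"] by (simp add: add_divide_distrib)
  qed
  with \<open>h < c\<close> show False by simp
qed

end

section \<open>Minimal codes\<close>

text \<open>The additive constant disappears after division by n. The slacks form a sequence so that
  almost sure bounds for each of them hold simultaneously.\<close>

lemma limsup_le_of_linear_bounds:
  fixes f :: "nat \<Rightarrow> real"
  assumes "\<And>j. \<exists>K. \<forall>n\<ge>1. f n \<le> real n * (h + inverse (real (Suc j))) + K"
  shows "limsup (\<lambda>n. ereal (f n / real n)) \<le> ereal h"
proof (rule ereal_le_epsilon2)
  fix e :: real assume e: "0 < e"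
  then obtain j where j: "inverse (real (Suc j)) < e / 2" using reals_Archimedean half_gt_zero by blast
  obtain K where K: "f n \<le> real n * (h + inverse (real (Suc j))) + K" if "n \<ge> 1" for n
    using assms by blast
  have "(\<lambda>n. K / real n) \<longlonglongrightarrow> 0" by (rule lim_const_over_n)
  then have "eventually (\<lambda>n. K / real n < e / 2) sequentially"
    using e by (intro order_tendstoD) auto
  then have "eventually (\<lambda>n. ereal (f n / real n) \<le> ereal h + ereal e) sequentially"
    using eventually_ge_at_top[of 1]
  proof eventually_elim
    case (elim n)
    have "f n / real n \<le> (real n * (h + inverse (real (Suc j))) + K) / real n"
      using K[OF elim(2)] by (intro divide_right_mono) auto
    also have "\<dots> = h + inverse (real (Suc j)) + K / real n"
      using elim(2) by (simp add: add_divide_distrib)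
    also have "\<dots> \<le> h + e" using j elim(1) by linarith
    finally show ?case by simp
  qed
  then show "limsup (\<lambda>n. ereal (f n / real n)) \<le> ereal h + ereal e"
    by (rule Limsup_bounded)
qed

text \<open>The minimal code is compared with the block grammar ranked by Markov weights. Half of
  the slack \<delta> goes to the encoder and the entropy increment, half to the overhead per
  block.\<close>

lemma (in finite_process) AE_minimal_code_linear_bound:
  fixes BS :: "nat \<Rightarrow> nat list"
  assumes D: "D \<ge> 1" and DY: "DY \<ge> 2" and enc: "nat_encoder DY BS"
    and lim: "limsup (\<lambda>n. ereal (real (length (BS n)) / log (real DY) (real n))) = 1"
    and J: "{G. inB D G} \<subseteq> J" and min: "minimal_code D BS J \<Gamma>"
    and erg: "ergodic_process M X"
    and ent: "(\<lambda>n. block_entropy D M X n / real n) \<longlonglongrightarrow> h" and h: "h > 0" and \<delta>: "\<delta> > 0"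
  shows "AE \<omega> in M. \<exists>K. \<forall>n\<ge>1. real (length (local_encoder D BS (\<Gamma> (window 0 n (path \<omega>))))) * ln (real DY)
    \<le> real n * (h + \<delta>) + K"
proof -
  let ?p = "block_prob M X"
  \<comment> \<open>Chosen so that (1 + \<epsilon>)(h + \<epsilon>) \<le> h + \<epsilon>(h + 2)
    \<le> h + \<delta>/2, where the first step uses \<epsilon> \<le> 1.\<close>
  define \<epsilon> where "\<epsilon> = min 1 (\<delta> / (2 * (h + 2)))"
  have \<epsilon>: "\<epsilon> > 0" "\<epsilon> \<le> 1" using h \<delta> by (auto simp: \<epsilon>_def)
  have "\<epsilon> * (h + 2) \<le> \<delta> / (2 * (h + 2)) * (h + 2)"
    using h by (intro mult_right_mono) (auto simp: \<epsilon>_def)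
  also have "\<dots> = \<delta> / 2" using h by (simp add: field_simps)
  finally have "\<epsilon> * (h + 2) \<le> \<delta> / 2" .
  moreover have "\<epsilon> * \<epsilon> \<le> \<epsilon> * 1" using \<epsilon> by (intro mult_left_mono) auto
  ultimately have rate: "(1 + \<epsilon>) * (h + \<epsilon>) \<le> h + \<delta> / 2"
    by (simp add: algebra_simps)
  obtain C where C: "C \<ge> 0" and code:
    "\<And>k Q w. k \<ge> 1 \<Longrightarrow> (\<And>v. v \<in> words D k \<Longrightarrow> Q v \<ge> 0) \<Longrightarrow> sum Q (words D k) \<le> 1 \<Longrightarrow>
      set w \<subseteq> {..<D} \<Longrightarrow> (\<And>t. t < length w div k \<Longrightarrow> Q (block k w t) > 0) \<Longrightarrow>
      \<exists>G. inB D G \<and> generates D G w \<and>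
        real (length (local_encoder D BS G)) * ln (real DY) \<le>
          (\<Sum>t<length w div k. (1 + \<epsilon>) * (- ln (Q (block k w t))) + C) +
          real ((k + 1) * length (BS (D + 1)) * (1 + D ^ k)) * ln (real DY)"
    using block_code_bound[OF enc DY lim \<epsilon>(1), of D] by blast
  obtain m where m: "block_entropy D M X (Suc m) - block_entropy D M X m < h + \<epsilon>"
    using exists_small_entropy_increment[OF ent, of "h + \<epsilon>"] \<epsilon> by auto
  \<comment> \<open>The overhead per block: the m initial letters coded uniformly, and the constant
    of the encoder.\<close>
  define A where "A = (1 + \<epsilon>) * (real m * ln (real D)) + C"
  have A: "A \<ge> 0" using C \<epsilon> D by (simp add: A_def)
  obtain k0 :: nat where k0: "2 * A / \<delta> < real k0" using reals_Archimedean2 by blast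
  \<comment> \<open>As \<open>A\<close> depends on m but not on k, blocks long enough make
    \<open>A / k\<close> at most \<delta>/2.\<close>
  define k where "k = m + Suc k0"
  have k: "k \<ge> 1" "m < k" "real k > 0" by (auto simp: k_def)
  have "2 * A / \<delta> \<le> real k" using k0 by (simp add: k_def)
  then have Ak: "A / real k \<le> \<delta> / 2" using k \<delta> by (simp add: field_simps)
  \<comment> \<open>The cost of the rule bodies and of the incomplete last block, constant in
    n.\<close>
  define Kk where "Kk = real ((k + 1) * length (BS (D + 1)) * (1 + D ^ k)) * ln (real DY)"
  show ?thesis
    using AE_block_prob_window_pos AE_sum_cond_info_le[OF erg m] AE_space
  proof eventually_elim
    case (elim \<omega>)
    obtain K1 where K1: "(\<Sum>s<n. cond_info m s (path \<omega>)) \<le> real n * (h + \<epsilon>) + K1" for n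
      using elim(2) by blast
    have pos: "?p (window s l (path \<omega>)) > 0" for s l using elim(1) by blast
    \<comment> \<open>Extending a word cannot raise its probability.\<close>
    have g: "cond_info m s (path \<omega>) \<ge> 0" for s
      using pos[of s m] pos[of s "Suc m"] block_prob_snoc_le
      unfolding cond_info_def window_Suc by simp
    have "real (length (local_encoder D BS (\<Gamma> (window 0 n (path \<omega>))))) * ln (real DY)
        \<le> real n * (h + \<delta>) + ((1 + \<epsilon>) * K1 + Kk)" if n: "n \<ge> 1" for n
    proof -
      define w where "w = window 0 n (path \<omega>)"
      define N where "N = length w div k"
      define Q where "Q = markov_weight D ?p m"
      have w: "length w = n" "set w \<subseteq> {..<D}"
        using window_in_words[OF elim(3), of 0 n] by (auto simp: w_def)
      have "w \<noteq> []" using w(1) n by auto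
      have win: "?p (take (Suc m) (drop s w)) > 0 \<and> ?p (take m (drop s w)) > 0 \<and>
          cond_info m s (path \<omega>) = ln (?p (take m (drop s w))) - ln (?p (take (Suc m) (drop s w)))"
        if s: "s + m < length w" for s
      proof -
        have "s + m \<le> n" "s + Suc m \<le> n" using s w(1) by auto
        then have "take m (drop s w) = window s m (path \<omega>)"
          "take (Suc m) (drop s w) = window s (Suc m) (path \<omega>)"
          unfolding w_def by (subst take_drop_window; simp)+
        then show ?thesis using pos by (simp only: cond_info_def)
      qed
      have Qpos: "Q (block k w t) > 0" if "t < N" for t
        unfolding Q_def
        by (rule sum_ln_markov_weight_blocks(1)[OF D k(2) g win that[unfolded N_def]])
      have Qsum: "(\<Sum>t<N. - ln (Q (block k w t))) \<le>
          real N * (real m * ln (real D)) + (\<Sum>s<n. cond_info m s (path \<omega>))"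
        unfolding Q_def N_def using sum_ln_markov_weight_blocks(2)[OF D k(2) g win] w(1) by simp
      have Q0: "Q v \<ge> 0" for v
        unfolding Q_def by (rule markov_weight_nonneg) (rule block_prob_nonneg)
      have "sum Q (words D k) \<le> 1"
        unfolding Q_def k_def
        by (rule sum_markov_weight_le_1[OF D block_prob_nonneg sum_block_prob_snoc])
      from code[OF k(1) Q0 this w(2) Qpos[unfolded N_def]]
      obtain G where G: "inB D G" "generates D G w" and len:
        "real (length (local_encoder D BS G)) * ln (real DY) \<le>
          (\<Sum>t<N. (1 + \<epsilon>) * (- ln (Q (block k w t))) + C) + Kk"
        unfolding N_def Kk_def by blast
      \<comment> \<open>The N blocks occupy at most n letters, so N \<le> n / k.\<close>
      have NA: "real N * A \<le> real n * (\<delta> / 2)"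
      proof -
        have "N * k \<le> n" using w(1) by (simp add: N_def)
        then have "real N * real k \<le> real n" by (metis of_nat_le_iff of_nat_mult)
        then have "real N \<le> real n / real k" using k by (simp add: field_simps)
        then have "real N * A \<le> real n / real k * A" using A by (rule mult_right_mono)
        also have "\<dots> = real n * (A / real k)" by simp
        also have "\<dots> \<le> real n * (\<delta> / 2)" using Ak by (intro mult_left_mono) auto
        finally show ?thesis .
      qed
      \<comment> \<open>The block grammar lies in \<open>J\<close> and generates w, so it competes
        with the minimal one.\<close>
      have "length (local_encoder D BS (\<Gamma> w)) \<le> length (local_encoder D BS G)"
        using min w(2) \<open>w \<noteq> []\<close> G J unfolding minimal_code_def by blast
      then have "real (length (local_encoder D BS (\<Gamma> w))) * ln (real DY)
          \<le> real (length (local_encoder D BS G)) * ln (real DY)"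
        using DY by (intro mult_right_mono) auto
      moreover have "(\<Sum>t<N. (1 + \<epsilon>) * (- ln (Q (block k w t))) + C) =
          (1 + \<epsilon>) * (\<Sum>t<N. - ln (Q (block k w t))) + real N * C"
        by (simp only: sum.distrib sum_distrib_left sum_constant card_lessThan)
      moreover have "(1 + \<epsilon>) * (\<Sum>t<N. - ln (Q (block k w t))) \<le>
          (1 + \<epsilon>) * (real N * (real m * ln (real D)) + (real n * (h + \<epsilon>) + K1))"
        using \<epsilon> order_trans[OF Qsum add_left_mono[OF K1[of n]]] by (intro mult_left_mono) auto
      moreover have "(1 + \<epsilon>) * (real N * (real m * ln (real D)) + (real n * (h + \<epsilon>) + K1)) + real N * C =
          real n * ((1 + \<epsilon>) * (h + \<epsilon>)) + real N * A + (1 + \<epsilon>) * K1"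
        by (simp add: A_def algebra_simps)
      moreover have "real n * ((1 + \<epsilon>) * (h + \<epsilon>)) \<le> real n * (h + \<delta> / 2)"
        using rate by (intro mult_left_mono) auto
      moreover have "real n * (h + \<delta> / 2) + real n * (\<delta> / 2) = real n * (h + \<delta>)"
        by (simp add: algebra_simps)
      ultimately show ?thesis
        using len NA unfolding w_def[symmetric] by linarith
    qed
    then show ?case by blast
  qed
qed

theorem theorem5:
  fixes DX DY :: nat and BS :: "nat \<Rightarrow> nat list" and J :: "gsym list list set"
    and \<Gamma> :: "nat list \<Rightarrow> gsym list list"
    and M :: "'a measure" and X :: "int \<Rightarrow> 'a \<Rightarrow> nat" and h :: real
  assumes "DX \<ge> 1" and "DY \<ge> 2"
    and "nat_encoder DY BS"
    and "limsup (\<lambda>n. ereal (real (length (BS n)) / log (real DY) (real n))) = 1"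
    and "{G. inB DX G} \<subseteq> J" and "sufficient DX J"
    and "minimal_code DX BS J \<Gamma>"
    and "prob_space M"
    and "\<forall>k. X k \<in> measurable M (count_space UNIV)"
    and "\<forall>k. \<forall>\<omega>\<in>space M. X k \<omega> < DX"
    and "stationary_process M X" and "ergodic_process M X"
    and "(\<lambda>n. block_entropy DX M X n / real n) \<longlonglongrightarrow> h" and "h > 0"
  shows "AE \<omega> in M. limsup (\<lambda>n. ereal (real (length (local_encoder DX BS
             (\<Gamma> (map (\<lambda>i. X (int i) \<omega>) [1..<n + 1])))) * ln (real DY) / real n)) \<le> ereal h"
proof -
  interpret finite_process M DX X
    by (intro finite_process.intro finite_process_axioms.intro) (use assms(8-11) in blast)+
  let ?f = "\<lambda>\<omega> n. real (length (local_encoder DX BS (\<Gamma> (window 0 n (\<lambda>i. X i \<omega>))))) * ln (real DY)"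
  \<comment> \<open>The slacks 1/(j + 1) are countably many, so a single null set serves them
    all.\<close>
  have "AE \<omega> in M. \<exists>K. \<forall>n\<ge>1. ?f \<omega> n \<le> real n * (h + inverse (real (Suc j))) + K" for j
    by (rule AE_minimal_code_linear_bound[OF assms(1-5,7,12-14)]) simp
  then have "AE \<omega> in M. \<forall>j. \<exists>K. \<forall>n\<ge>1. ?f \<omega> n \<le> real n * (h + inverse (real (Suc j))) + K"
    unfolding AE_all_countable by blast
  then show ?thesis
  proof eventually_elim
    case (elim \<omega>)
    have eq: "window 0 n (\<lambda>i. X i \<omega>) = map (\<lambda>i. X (int i) \<omega>) [1..<n + 1]" for n
      by (rule nth_equalityI) (auto simp: nth_window add.commute simp del: upt_Suc)
    show ?case
      using limsup_le_of_linear_bounds[of "?f \<omega>" h] elim unfolding eq by blast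
  qed
qed

end
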